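(* Let $\lambda=1/\sqrt{5}$ and let $B$ be the closed unit ball of $\mathbb{R}^3$. Then there exists a $\lambda$-eel $\gamma:[0,+\infty)\to B$ of infinite length. Moreover, $\lim_{t\to\infty}\gamma(t)$ exists.
   Context: $\mathbb{R}^3$ carries the Euclidean inner product $\langle\cdot,\cdot\rangle$ and norm $\|\cdot\|$. For $\lambda\in[-1,1)$, a $\lambda$-eel is a continuous curve $\gamma:I\to\mathbb{R}^d$ ($I$ an interval) which has at each point a nonzero right derivative $\gamma'(\tau)$ and satisfies, for all $t<\tau$ in $I$, $\langle\gamma'(\tau),\gamma(t)-\gamma(\tau)\rangle\le\lambda\,\|\gamma'(\tau)\|\,\|\gamma(t)-\gamma(\tau)\|$. The length of $\gamma$ is $\sup\sum_{i=0}^{m-1}\|\gamma(t_i)-\gamma(t_{i+1})\|$ over all finite increasing sequences $t_0<\dots<t_m$ in $I$. *)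

theory Defs
  imports "HOL-Analysis.Analysis"
begin

definition right_deriv_at :: "(real \<Rightarrow> 'a::real_normed_vector) \<Rightarrow> real set \<Rightarrow> real \<Rightarrow> 'a \<Rightarrow> bool" where
  "right_deriv_at g I tau v \<longleftrightarrow> (g has_vector_derivative v) (at tau within (I \<inter> {tau..}))"

definition is_eel :: "real \<Rightarrow> real set \<Rightarrow> (real \<Rightarrow> 'a::real_inner) \<Rightarrow> bool" where
  "is_eel lam I g \<longleftrightarrow> is_interval I \<and> continuous_on I g \<and>
     (\<forall>tau\<in>I. \<exists>v. v \<noteq> 0 \<and> right_deriv_at g I tau v \<and>
        (\<forall>t\<in>I. t < tau \<longrightarrow> inner v (g t - g tau) \<le> lam * norm v * norm (g t - g tau)))"

definition curve_length :: "real set \<Rightarrow> (real \<Rightarrow> 'a::real_normed_vector) \<Rightarrow> ereal" where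
  "curve_length I g = (SUP ts \<in> {ts. sorted_wrt (<) ts \<and> set ts \<subseteq> I}.
      ereal (\<Sum>i<length ts - 1. dist (g (ts ! i)) (g (ts ! Suc i))))"

end

theory Submission
  imports Defs
begin

text \<open>
A straight axis can be wrapped by a helix of slope $2/5$ and arbitrarily small radius: seen from the
helix, the axis stays outside the forward cone, because $\frac{2/5}{\sqrt{1 + (2/5)^2}} < 1/\sqrt{5}$.
The slack allows one to replace the axis by everything inside a cylinder of a tenth of the radius, so
one can wrap alternately downwards and upwards with radii growing by factors of $10$. Starting from a
tiny radius, arbitrarily many passes of a given height $G$ fit in a thin cylinder; after an even number
of passes, of total length at least $1$, the curve is at the top of everything built so far.
It then moves straight up by $G/2$; this puts all of the past in a narrow downward cone, which is
harmless for the next batch, of height $G/2$ and wound around the continuation of that vertical line.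
The heights are summable, so the curve converges, while every batch has length at least $1$.
\<close>

section \<open>Partial eels on \<open>{0..S}\<close> and how to prolong them\<close>

text \<open>The domain is fixed as the half-line from 0, so that for \<open>tau \<ge> 0\<close> this
  is the condition of \<open>is_eel\<close> on \<open>{0..}\<close>. It depends on \<open>g\<close>
  only on \<open>[0, tau]\<close> and on the germ to the right of \<open>tau\<close>, which is what
  makes a step-by-step construction possible.\<close>

definition eel_at :: "real \<Rightarrow> (real \<Rightarrow> 'a::real_inner) \<Rightarrow> real \<Rightarrow> bool" where
  "eel_at lam g tau \<longleftrightarrow> (\<exists>v. v \<noteq> 0 \<and> (g has_vector_derivative v) (at tau within {tau..}) \<and>
     (\<forall>t\<in>{0..<tau}. inner v (g t - g tau) \<le> lam * norm v * norm (g t - g tau)))"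

definition polygon_length :: "(real \<Rightarrow> 'a::metric_space) \<Rightarrow> real list \<Rightarrow> real" where
  "polygon_length g ts = (\<Sum>i<length ts - 1. dist (g (ts ! i)) (g (ts ! Suc i)))"

text \<open>Requiring the polygon to end at \<open>S\<close> lets a later extension append one
  vertex and gain the full chord from \<open>g S\<close>.\<close>

definition length_ge :: "(real \<Rightarrow> 'a::metric_space) \<Rightarrow> real \<Rightarrow> real \<Rightarrow> bool" where
  "length_ge g S l \<longleftrightarrow> (\<exists>ts. sorted_wrt (<) ts \<and> set ts \<subseteq> {0..S} \<and> ts \<noteq> [] \<and> last ts = S \<and>
     l \<le> polygon_length g ts)"

text \<open>The endpoint \<open>S\<close> is left out of the eel condition: the right derivative
  there is fixed only by the next arc.\<close>

definition partial_eel :: "real \<Rightarrow> (real \<Rightarrow> 'a::real_inner) \<Rightarrow> real \<Rightarrow> real \<Rightarrow> bool" where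
  "partial_eel lam g S l \<longleftrightarrow> 0 \<le> S \<and> continuous_on {0..S} g \<and> (\<forall>tau\<in>{0..<S}. eel_at lam g tau) \<and>
     length_ge g S l"

definition extends :: "(real \<Rightarrow> 'a) \<Rightarrow> real \<Rightarrow> (real \<Rightarrow> 'a) \<Rightarrow> real \<Rightarrow> 'a set \<Rightarrow> bool" where
  "extends g S g' S' Q \<longleftrightarrow> S \<le> S' \<and> (\<forall>t\<in>{0..S}. g' t = g t) \<and> g' ` {S..S'} \<subseteq> Q"

lemma extends_mono: "extends g S g' S' Q \<Longrightarrow> Q \<subseteq> Q' \<Longrightarrow> extends g S g' S' Q'"
  by (auto simp: extends_def)

lemma extends_refl: "g S \<in> Q \<Longrightarrow> extends g S g S Q"
  by (auto simp: extends_def)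

lemma extends_trans:
  assumes "extends g S g1 S1 Q" "extends g1 S1 g2 S2 Q" "0 \<le> S"
  shows "extends g S g2 S2 Q"
  unfolding extends_def
proof (intro conjI ballI subsetI)
  fix p assume "p \<in> g2 ` {S..S2}"
  then obtain t where t: "t \<in> {S..S2}" "p = g2 t" by auto
  show "p \<in> Q"
  proof (cases "t \<le> S1")
    case True
    then have "p = g1 t" using assms t by (auto simp: extends_def)
    then show ?thesis using assms t True by (auto simp: extends_def)
  qed (use assms t in \<open>auto simp: extends_def\<close>)
qed (use assms in \<open>auto simp: extends_def\<close>)

lemma extends_image:
  assumes "extends g S g' S' Q" "0 \<le> S"
  shows "g' ` {0..S'} \<subseteq> g ` {0..S} \<union> Q"
proof
  fix p assume "p \<in> g' ` {0..S'}"
  then obtain t where t: "t \<in> {0..S'}" "p = g' t" by auto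
  then show "p \<in> g ` {0..S} \<union> Q"
    using assms by (cases "t \<le> S") (auto simp: extends_def image_subset_iff)
qed

lemma polygon_length_snoc:
  assumes "ts \<noteq> []"
  shows "polygon_length g (ts @ [t]) = polygon_length g ts + dist (g (last ts)) (g t)"
proof -
  obtain n where n: "length ts = Suc n" using assms by (cases ts) auto
  have "(\<Sum>i<n. dist (g ((ts @ [t]) ! i)) (g ((ts @ [t]) ! Suc i)))
      = (\<Sum>i<n. dist (g (ts ! i)) (g (ts ! Suc i)))"
    using n by (intro sum.cong) (auto simp: nth_append)
  then show ?thesis
    using n assms by (simp add: polygon_length_def nth_append last_conv_nth)
qed

lemma polygon_length_cong:
  assumes "\<And>t. t \<in> set ts \<Longrightarrow> g t = g' t"
  shows "polygon_length g ts = polygon_length g' ts"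
  unfolding polygon_length_def using assms by (intro sum.cong) auto

lemma length_ge_extend:
  assumes "length_ge g S l" "S < S'" "0 \<le> S" "\<And>t. t \<in> {0..S} \<Longrightarrow> g' t = g t"
    "l' \<le> l + dist (g' S) (g' S')"
  shows "length_ge g' S' l'"
proof -
  obtain ts where ts: "sorted_wrt (<) ts" "set ts \<subseteq> {0..S}" "ts \<noteq> []" "last ts = S"
     "l \<le> polygon_length g ts" using assms by (auto simp: length_ge_def)
  have "polygon_length g ts = polygon_length g' ts"
    using ts assms(4) by (intro polygon_length_cong) (auto simp: subset_iff)
  then have "l' \<le> polygon_length g' (ts @ [S'])"
    using ts assms(5) by (simp add: polygon_length_snoc)
  moreover have "sorted_wrt (<) (ts @ [S'])" using ts assms(2) by (force simp: sorted_wrt_append)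
  moreover have "set (ts @ [S']) \<subseteq> {0..S'}" using ts assms by force
  ultimately show ?thesis unfolding length_ge_def by (intro exI[of _ "ts @ [S']"]) auto
qed

lemma vector_derivative_right_cong:
  fixes f g :: "real \<Rightarrow> 'a::real_normed_vector"
  assumes "(f has_vector_derivative v) (at s within {s..})" "0 < e"
    "\<And>t. s \<le> t \<Longrightarrow> t < s + e \<Longrightarrow> g t = f t"
  shows "(g has_vector_derivative v) (at s within {s..})"
  by (rule has_vector_derivative_transform_within[OF assms(1,2)])
     (use assms(3) in \<open>auto simp: dist_real_def\<close>)

lemma eel_at_cong:
  assumes "eel_at lam f s" "0 < e" "\<And>t. 0 \<le> t \<Longrightarrow> t < s + e \<Longrightarrow> g t = f t" "0 \<le> s"
  shows "eel_at lam g s"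
proof -
  obtain v where v: "v \<noteq> 0" "(f has_vector_derivative v) (at s within {s..})"
     "\<forall>t\<in>{0..<s}. inner v (f t - f s) \<le> lam * norm v * norm (f t - f s)"
    using assms(1) by (auto simp: eel_at_def)
  have "(g has_vector_derivative v) (at s within {s..})"
    by (rule vector_derivative_right_cong[OF v(2) assms(2)]) (use assms in auto)
  then show ?thesis unfolding eel_at_def using v assms by (intro exI[of _ v]) auto
qed

text \<open>Corners cost nothing, because only right derivatives matter. Appending an arc
  \<open>c\<close> therefore leaves just two checks for each new point: against the old curve
  (\<open>past\<close>) and against the earlier part of \<open>c\<close> (\<open>self\<close>). The
  credited length grows by the chord of \<open>c\<close> only.\<close>

lemma partial_eel_extend:
  fixes g c :: "real \<Rightarrow> 'a::real_inner"
  assumes g: "partial_eel lam g S l" and T: "0 < T" and c0: "c 0 = g S"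
    and d: "\<And>s. s \<in> {0..T} \<Longrightarrow> (c has_vector_derivative d s) (at s)"
    and nz: "\<And>s. s \<in> {0..<T} \<Longrightarrow> d s \<noteq> 0"
    and past: "\<And>s p. s \<in> {0..<T} \<Longrightarrow> p \<in> g ` {0..S} \<Longrightarrow>
       inner (d s) (p - c s) \<le> lam * norm (d s) * norm (p - c s)"
    and self: "\<And>s s'. s \<in> {0..<T} \<Longrightarrow> s' \<in> {0..<s} \<Longrightarrow>
       inner (d s) (c s' - c s) \<le> lam * norm (d s) * norm (c s' - c s)"
    and l': "l' \<le> l + dist (c 0) (c T)"
  shows "\<exists>g' S'. partial_eel lam g' S' l' \<and> S' = S + T \<and> g' S' = c T \<and> extends g S g' S' (c ` {0..T})"
proof -
  define g' where "g' = (\<lambda>t. if t \<le> S then g t else c (t - S))"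
  have S: "0 \<le> S" using g by (simp add: partial_eel_def)
  have right: "g' t = c (t - S)" if "S \<le> t" for t using that c0 by (auto simp: g'_def)
  have left: "g' t = g t" if "t \<le> S" for t using that by (auto simp: g'_def)
  have contc: "continuous_on {0..T} c"
    using d by (intro continuous_at_imp_continuous_on ballI) (blast intro: has_vector_derivative_continuous)
  have "continuous_on ({0..S} \<union> {S..S+T}) g'"
  proof (rule continuous_on_closed_Un)
    show "continuous_on {0..S} g'"
      using g by (subst continuous_on_cong[OF refl left]) (auto simp: partial_eel_def)
    have "continuous_on {S..S+T} (\<lambda>t. c (t - S))"
      by (rule continuous_on_compose2[OF contc]) (auto intro!: continuous_intros)
    then show "continuous_on {S..S+T} g'"
      by (subst continuous_on_cong[OF refl right]) auto
  qed auto
  moreover have "{0..S} \<union> {S..S+T} = {0..S+T}" using S T by auto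
  ultimately have cont: "continuous_on {0..S+T} g'" by simp
  have eel: "eel_at lam g' tau" if tau: "tau \<in> {0..<S+T}" for tau
  proof (cases "tau < S")
    case True
    show ?thesis
      by (rule eel_at_cong[of lam g tau "S - tau"]) (use True tau g left in \<open>auto simp: partial_eel_def\<close>)
  next
    \<comment> \<open>The junction \<open>tau = S\<close> belongs to this case: the direction there
      is \<open>d 0\<close>, whatever the direction in which \<open>g\<close> arrived.\<close>
    case False
    define s where "s = tau - S"
    have s: "s \<in> {0..<T}" "tau = S + s" using False tau by (auto simp: s_def)
    have "(c has_vector_derivative d s) (at s)" using s d by auto
    moreover have "((\<lambda>t. t - S) has_vector_derivative 1) (at tau)"
      by (auto simp: has_vector_derivative_def intro!: derivative_eq_intros)
    ultimately have "((\<lambda>t. c (t - S)) has_vector_derivative d s) (at tau)"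
      using vector_diff_chain_at[of "\<lambda>t. t - S" 1 tau c "d s"] s by (auto simp: o_def)
    then have "((\<lambda>t. c (t - S)) has_vector_derivative d s) (at tau within {tau..})"
      by (rule has_vector_derivative_at_within)
    then have "(g' has_vector_derivative d s) (at tau within {tau..})"
      by (rule vector_derivative_right_cong[where e = 1]) (use False right in auto)
    moreover have "inner (d s) (g' t - g' tau) \<le> lam * norm (d s) * norm (g' t - g' tau)"
      if t: "t \<in> {0..<tau}" for t
    proof (cases "t \<le> S")
      case True
      then show ?thesis using past[of s "g t"] s t left[of t] right[of tau] False by auto
    next
      case False
      then show ?thesis using self[of s "t - S"] s t right[of t] right[of tau] by auto
    qed
    ultimately show ?thesis unfolding eel_at_def using nz s by blast
  qed
  have "length_ge g' (S+T) l'"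
    by (rule length_ge_extend[of g S l]) (use g T S l' right left c0 in \<open>auto simp: partial_eel_def\<close>)
  then have "partial_eel lam g' (S+T) l'" unfolding partial_eel_def using cont eel S T by auto
  moreover have "extends g S g' (S+T) (c ` {0..T})"
    unfolding extends_def using left right T by (force simp: image_iff)
  ultimately show ?thesis using right[of "S+T"] T by auto
qed

section \<open>The squared eel inequality and radial moves\<close>

text \<open>Squaring removes \<open>sqrt 5\<close> and the norms, so that every later check becomes
  a polynomial inequality with rational coefficients. The bound \<open>X\<close> may be cruder than
  the inner product itself; if it is not positive, there is nothing to square.\<close>

lemma eel_inequality:
  fixes v w :: "'a::real_inner"
  assumes "inner v w \<le> X" "X \<le> 0 \<or> 5 * X\<^sup>2 \<le> inner v v * inner w w"
  shows "inner v w \<le> 1 / sqrt 5 * norm v * norm w"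
proof (cases "X \<le> 0")
  case True
  then show ?thesis using assms(1) by (smt (verit) divide_nonneg_nonneg mult_nonneg_nonneg norm_ge_zero real_sqrt_ge_zero)
next
  case False
  then have "5 * X\<^sup>2 \<le> inner v v * inner w w" using assms(2) by simp
  then have "X\<^sup>2 \<le> (1 / sqrt 5 * norm v * norm w)\<^sup>2"
    by (simp add: power_mult_distrib power_divide dot_square_norm)
  then have "X \<le> 1 / sqrt 5 * norm v * norm w"
    by (rule power2_le_imp_le) simp
  then show ?thesis using assms(1) by simp
qed

text \<open>
Sets that a helix around the vertical line through \<open>c\<close>, staying above height \<open>a\<close>, may have in its
past: a thin cylinder, and the narrow downward cone with apex \<open>(c, a)\<close> containing the earlier batches.
\<close>

definition near_axis :: "complex \<Rightarrow> real \<Rightarrow> real \<Rightarrow> (complex \<times> real) set" where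
  "near_axis c \<rho> a = {(w, z). cmod (w - c) \<le> \<rho> \<or> cmod (w - c) \<le> 2/25 * (a - z)}"

definition solid_cylinder :: "complex \<Rightarrow> real \<Rightarrow> real \<Rightarrow> real \<Rightarrow> (complex \<times> real) set" where
  "solid_cylinder c r a b = {(w, z). cmod (w - c) \<le> r \<and> a \<le> z \<and> z \<le> b}"

lemma near_axis_mono: "\<rho> \<le> r \<Longrightarrow> near_axis c \<rho> a \<subseteq> near_axis c r a"
  by (auto simp: near_axis_def)

lemma solid_cylinder_mono: "\<rho> \<le> r \<Longrightarrow> solid_cylinder c \<rho> a b \<subseteq> solid_cylinder c r a b"
  by (auto simp: solid_cylinder_def)

lemma solid_cylinder_near_axis: "solid_cylinder c r a b \<subseteq> near_axis c r a"
  by (auto simp: solid_cylinder_def near_axis_def)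

text \<open>This is the transition from one helix radius to the next. When moving horizontally
  outwards, the part of the past within distance \<open>\<rho>\<close> of the axis lies behind,
  while the part in the downward cone is seen almost vertically below.\<close>

lemma radial_segment:
  assumes g: "partial_eel (1 / sqrt 5) g S l" and gS: "g S = (c + of_real \<rho> * cis \<phi>, \<zeta>)"
    and past: "g ` {0..S} \<subseteq> near_axis c \<rho> a" and r: "0 \<le> \<rho>" "\<rho> < r" and "a \<le> \<zeta>"
  shows "\<exists>g' S'. partial_eel (1 / sqrt 5) g' S' l \<and> g' S' = (c + of_real r * cis \<phi>, \<zeta>) \<and>
    extends g S g' S' ((\<lambda>q. (c + of_real q * cis \<phi>, \<zeta>)) ` {\<rho>..r})"
proof -
  define k where "k = (\<lambda>s::real. (c + of_real (\<rho> + s) * cis \<phi>, \<zeta>))"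
  define d where "d = (\<lambda>s::real. (cis \<phi>, 0::real))"
  have ex: "\<exists>g' S'. partial_eel (1 / sqrt 5) g' S' l \<and> S' = S + (r - \<rho>) \<and> g' S' = k (r - \<rho>) \<and>
      extends g S g' S' (k ` {0..r - \<rho>})"
  proof (rule partial_eel_extend[where d = d, OF g])
    show "(k has_vector_derivative d s) (at s)" for s
      unfolding k_def d_def
      by (auto intro!: derivative_eq_intros has_vector_derivative_Pair simp: has_vector_derivative_def scaleR_conv_of_real)
    show "inner (d s) (p - k s) \<le> 1 / sqrt 5 * norm (d s) * norm (p - k s)"
      if s: "s \<in> {0..<r - \<rho>}" and p: "p \<in> g ` {0..S}" for s p
    proof -
      obtain w z where wz: "p = (w, z)" by (cases p)
      have "inner (cis \<phi>) (w - c) \<le> cmod (w - c)"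
        using norm_cauchy_schwarz[of "cis \<phi>" "w - c"] by simp
      moreover have "inner (cis \<phi>) (of_real (\<rho> + s) * cis \<phi>) = \<rho> + s"
        using inner_scaleR_right[of "cis \<phi>" "\<rho> + s" "cis \<phi>"]
        by (simp only: scaleR_conv_of_real dot_square_norm norm_cis) simp
      moreover have "inner (d s) (p - k s) =
          inner (cis \<phi>) (w - c) - inner (cis \<phi>) (of_real (\<rho> + s) * cis \<phi>)"
        unfolding d_def k_def wz by (simp add: inner_diff_right inner_add_right)
      ultimately have X: "inner (d s) (p - k s) \<le> cmod (w - c) - (\<rho> + s)" by simp
      have dd: "inner (d s) (d s) = 1"
        by (simp add: d_def dot_square_norm)
      have "(z - \<zeta>)\<^sup>2 \<le> inner (p - k s) (p - k s)"
        by (simp add: wz k_def power2_eq_square)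
      then have ww: "(\<zeta> - z)\<^sup>2 \<le> inner (p - k s) (p - k s)"
        by (simp add: power2_commute)
      consider "cmod (w - c) \<le> \<rho>" | "cmod (w - c) \<le> 2/25 * (a - z)"
        using past p wz by (auto simp: near_axis_def)
      then show ?thesis
      proof cases
        case 1
        then show ?thesis using X s by (intro eel_inequality[of _ _ 0]) auto
      next
        case 2
        then have "0 \<le> a - z" using order_trans[OF norm_ge_zero 2] by simp
        have sq: "5 * (2/25 * y)\<^sup>2 \<le> y\<^sup>2" for y :: real
          by (simp add: power_mult_distrib power2_eq_square)
        \<comment> \<open>In the cone the forward component is at most
          \<open>2/25 * (\<zeta> - z)\<close>, whereas the distance is at least the drop
          \<open>\<zeta> - z\<close>; and \<open>5 * (2/25)^2 < 1\<close>.\<close>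
        have le: "5 * (2/25 * (\<zeta> - z))\<^sup>2 \<le> inner (d s) (d s) * inner (p - k s) (p - k s)"
          unfolding dd mult_1 by (rule order_trans[OF sq ww])
        then show ?thesis
          using X s 2 \<open>a \<le> \<zeta>\<close> r
          by (intro eel_inequality[of _ _ "2/25 * (\<zeta> - z)"] disjI2[OF le]) auto
      qed
    qed
    show "inner (d s) (k s' - k s) \<le> 1 / sqrt 5 * norm (d s) * norm (k s' - k s)"
      if "s' \<in> {0..<s}" for s s'
    proof (rule eel_inequality[of _ _ 0])
      have "k s' - k s = - (s - s') *\<^sub>R d s"
        by (auto simp: k_def d_def scaleR_conv_of_real algebra_simps)
      then show "inner (d s) (k s' - k s) \<le> 0" using that by (simp add: mult_nonpos_nonneg)
    qed simp
  qed (use r gS in \<open>auto simp: k_def d_def zero_prod_def\<close>)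
  have sub: "k ` {0..r - \<rho>} \<subseteq> (\<lambda>q. (c + of_real q * cis \<phi>, \<zeta>)) ` {\<rho>..r}"
  proof
    fix p assume "p \<in> k ` {0..r - \<rho>}"
    then obtain s where "s \<in> {0..r - \<rho>}" "p = k s" by blast
    then show "p \<in> (\<lambda>q. (c + of_real q * cis \<phi>, \<zeta>)) ` {\<rho>..r}"
      using r unfolding k_def by (intro image_eqI[of _ _ "\<rho> + s"]) auto
  qed
  obtain g' S' where g': "partial_eel (1 / sqrt 5) g' S' l" "g' S' = k (r - \<rho>)"
    "extends g S g' S' (k ` {0..r - \<rho>})"
    using ex by blast
  have "g' S' = (c + of_real r * cis \<phi>, \<zeta>)" using g'(2) by (simp add: k_def)
  then show ?thesis using g'(1) extends_mono[OF g'(3) sub] by blast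
qed

section \<open>Helices of slope 2/5 and what they may have in their past\<close>

text \<open>The parameter \<open>t\<close> is the angle turned since the start, so the height
  changes by \<open>2/5\<close> per unit of horizontal arc. The sign \<open>\<sigma>\<close> is 1
  for an ascending and -1 for a descending helix.\<close>

definition helix :: "complex \<Rightarrow> real \<Rightarrow> real \<Rightarrow> real \<Rightarrow> real \<Rightarrow> real \<Rightarrow> complex \<times> real" where
  "helix c r \<phi> \<zeta> \<sigma> t = (c + of_real r * cis (\<phi> + t), \<zeta> + 2/5 * \<sigma> * r * t)"

definition helix_velocity :: "real \<Rightarrow> real \<Rightarrow> real \<Rightarrow> real \<Rightarrow> complex \<times> real" where
  "helix_velocity r \<phi> \<sigma> t = (of_real r * (\<i> * cis (\<phi> + t)), 2/5 * \<sigma> * r)"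

lemma helix_has_derivative:
  "(helix c r \<phi> \<zeta> \<sigma> has_vector_derivative helix_velocity r \<phi> \<sigma> t) (at t)"
proof -
  have "((\<lambda>t. cis (\<phi> + t)) has_vector_derivative \<i> * cis (\<phi> + t)) (at t)"
    by (auto simp: has_vector_derivative_def intro!: derivative_eq_intros)
  then show ?thesis
    unfolding helix_def helix_velocity_def
    by (auto intro!: derivative_eq_intros has_vector_derivative_Pair)
qed

lemma helix_velocity_square:
  assumes "\<sigma> \<in> {1, -1}"
  shows "inner (helix_velocity r \<phi> \<sigma> t) (helix_velocity r \<phi> \<sigma> t) = 29/25 * r\<^sup>2"
proof -
  have "inner (of_real r * (\<i> * cis (\<phi> + t))) (of_real r * (\<i> * cis (\<phi> + t))) = r\<^sup>2"
    by (simp add: dot_square_norm norm_mult)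
  then show ?thesis using assms by (auto simp: helix_velocity_def power2_eq_square)
qed

text \<open>During the first half turn the segment lies behind the helix, since
  \<open>sin t \<ge> 0\<close>; after that, the helix has climbed or descended far enough compared
  with its radius. The lemma serves twice: for the radial segment leading to the helix, and with
  \<open>q = r\<close> for the helix against itself.\<close>

lemma helix_inequality_segment:
  fixes \<phi> :: real and c :: complex and \<zeta> :: real
  assumes q: "0 \<le> q" "q \<le> r" and t: "0 \<le> t" and \<sigma>: "\<sigma> \<in> {1, -1}"
  defines "v \<equiv> helix_velocity r \<phi> \<sigma> t" and "x \<equiv> (c + of_real q * cis \<phi>, \<zeta>) - helix c r \<phi> \<zeta> \<sigma> t"
  shows "inner v x \<le> 1 / sqrt 5 * norm v * norm x"
proof -
  have r: "0 \<le> r" using q by simp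
  have \<sigma>2: "\<sigma> * \<sigma> = 1" using \<sigma> by auto
  have s: "sin t = sin (\<phi> + t) * cos \<phi> - cos (\<phi> + t) * sin \<phi>"
    using sin_diff[of "\<phi> + t" \<phi>] by simp
  have "inner v x = r * (- q * (sin (\<phi> + t) * cos \<phi> - cos (\<phi> + t) * sin \<phi>)) - 4/25 * (\<sigma> * \<sigma>) * r\<^sup>2 * t"
    unfolding v_def x_def helix_velocity_def helix_def
    by (simp add: inner_complex_def algebra_simps power2_eq_square)
  then have X: "inner v x = r * (- q * sin t - 4/25 * r * t)"
    unfolding s \<sigma>2 by (simp add: algebra_simps power2_eq_square)
  have xx: "4/25 * r\<^sup>2 * t\<^sup>2 \<le> inner x x"
  proof -
    have "inner x x = inner (fst x) (fst x) + 4/25 * (\<sigma> * \<sigma>) * r\<^sup>2 * t\<^sup>2"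
      by (simp add: x_def helix_def power2_eq_square algebra_simps inner_prod_def)
    then show ?thesis using \<sigma>2 by simp
  qed
  show ?thesis
  proof (cases "t \<le> pi")
    case True
    then have "0 \<le> sin t" using t by (simp add: sin_ge_zero)
    then have "0 \<le> q * sin t + 4/25 * r * t" using q r t by simp
    then have "r * (- q * sin t - 4/25 * r * t) \<le> 0" using r by (intro mult_nonneg_nonpos) auto
    then show ?thesis using X by (intro eel_inequality[of _ _ 0]) auto
  next
    case False
    \<comment> \<open>The rational bound \<open>t \<ge> 3\<close> suffices. The inner product is at
      most \<open>(1 - 3 * 4/25) * r^2 = 13/25 * r^2\<close>, the height difference alone gives a
      squared distance of at least \<open>(6/5 * r)^2\<close>, and
      \<open>5 * (13/25)^2 = 1.352\<close> is below \<open>29/25 * 36/25 = 1.6704\<close>.\<close>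
    then have t3: "3 \<le> t" using pi_gt3 by simp
    have "- q * sin t \<le> r"
      using mult_mono[of q r "- sin t" 1] sin_ge_minus_one[of t] q
      by (smt (verit) mult_le_cancel_left1 mult_minus_left mult_minus_right mult_nonneg_nonpos)
    moreover have "r * 3 \<le> r * t" using t3 r by (intro mult_left_mono)
    ultimately have "- q * sin t - 4/25 * r * t \<le> 13/25 * r" by simp
    then have "inner v x \<le> r * (13/25 * r)" unfolding X using r by (intro mult_left_mono)
    moreover have "5 * (r * (13/25 * r))\<^sup>2 \<le> inner v v * inner x x"
    proof -
      have "r\<^sup>2 * 3\<^sup>2 \<le> r\<^sup>2 * t\<^sup>2" using t3 by (intro mult_left_mono power_mono) auto
      then have "36/25 * r\<^sup>2 \<le> inner x x" using xx by simp
      then have "29/25 * r\<^sup>2 * (36/25 * r\<^sup>2) \<le> 29/25 * r\<^sup>2 * inner x x"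
        by (intro mult_left_mono) auto
      moreover have "5 * (r * (13/25 * r))\<^sup>2 \<le> 29/25 * r\<^sup>2 * (36/25 * r\<^sup>2)"
        using r by (simp add: power2_eq_square)
      ultimately show ?thesis
        unfolding v_def helix_velocity_square[OF \<sigma>] by linarith
    qed
    ultimately show ?thesis by (intro eel_inequality[of v x "r * (13/25 * r)"] disjI2)
  qed
qed

text \<open>The horizontal velocity is orthogonal to the radius vector, so the axis contributes only
  through the slope, with \<open>5 * (2/5)^2 = 4/5 < 29/25\<close>. The remaining slack pays for a
  horizontal offset from the axis: up to a tenth of the radius, or up to \<open>2/25\<close> of the
  height difference.\<close>

lemma helix_inequality_near_axis:
  fixes \<phi> :: real
  assumes r: "0 < r" "10 * \<rho> \<le> r" and \<sigma>: "\<sigma> \<in> {1, -1}" and p: "p \<in> near_axis c \<rho> a"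
    and a: "a \<le> snd (helix c r \<phi> \<zeta> \<sigma> t)"
  defines "v \<equiv> helix_velocity r \<phi> \<sigma> t" and "x \<equiv> p - helix c r \<phi> \<zeta> \<sigma> t"
  shows "inner v x \<le> 1 / sqrt 5 * norm v * norm x"
proof -
  obtain w z where wz: "p = (w, z)" by (cases p)
  define y where "y = z - snd (helix c r \<phi> \<zeta> \<sigma> t)"
  define e where "e = cis (\<phi> + t)"
  have e1: "cmod e = 1" by (simp add: e_def)
  have x: "x = (w - c - of_real r * e, y)"
    by (simp add: x_def y_def wz helix_def e_def)
  have inner_scale: "inner (of_real r * u) u' = r * inner u u'" "inner u (of_real r * u') = r * inner u u'"
    for u u' :: complex
    by (simp_all flip: scaleR_conv_of_real)
  have "inner (\<i> * e) e = 0"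
    by (simp add: inner_complex_def)
  then have "inner v x = r * inner (\<i> * e) (w - c) + 2/5 * r * (\<sigma> * y)"
    unfolding v_def x helix_velocity_def e_def[symmetric]
    by (simp add: inner_diff_right inner_scale right_diff_distrib)
  also have "\<dots> \<le> r * cmod (w - c) + 2/5 * r * \<bar>y\<bar>"
  proof (intro add_mono mult_left_mono)
    show "inner (\<i> * e) (w - c) \<le> cmod (w - c)"
      using norm_cauchy_schwarz[of "\<i> * e" "w - c"] by (simp add: norm_mult e1)
    show "\<sigma> * y \<le> \<bar>y\<bar>" using \<sigma> by auto
  qed (use r in auto)
  finally have X: "inner v x \<le> r * (cmod (w - c) + 2/5 * \<bar>y\<bar>)" by (simp add: algebra_simps)
  have vv: "inner v v = 29/25 * r\<^sup>2"
    using helix_velocity_square[OF \<sigma>, of r \<phi> t] by (simp add: v_def)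
  have xx: "inner x x = (cmod (w - c - of_real r * e))\<^sup>2 + \<bar>y\<bar>\<^sup>2"
    by (simp add: x power2_norm_eq_inner flip: power2_eq_square)
  consider "cmod (w - c) \<le> \<rho>" | "cmod (w - c) \<le> 2/25 * (a - z)"
    using p wz by (auto simp: near_axis_def)
  then show ?thesis
  proof cases
    case 1
    have "9/10 * r \<le> cmod (w - c - of_real r * e)"
      using norm_triangle_ineq2[of "of_real r * e" "w - c"] 1 r e1
      by (simp add: norm_mult norm_minus_commute)
    then have "(9/10 * r)\<^sup>2 \<le> (cmod (w - c - of_real r * e))\<^sup>2" using r by (intro power_mono) auto
    then have x2: "(9/10 * r)\<^sup>2 + \<bar>y\<bar>\<^sup>2 \<le> inner x x" using xx by simp
    \<comment> \<open>The mixed term \<open>2/5 * (r * \<bar>y\<bar>)\<close> is split by the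
      arithmetic-geometric mean inequality; the left side is then at most
      \<open>r^2/4 + y^2\<close>.\<close>
    have "5 * (r/10 + 2/5 * \<bar>y\<bar>)\<^sup>2 \<le> 29/25 * ((9/10 * r)\<^sup>2 + \<bar>y\<bar>\<^sup>2)"
    proof -
      have "0 \<le> (r - \<bar>y\<bar>)\<^sup>2" by simp
      then have "2 * (r * \<bar>y\<bar>) \<le> r\<^sup>2 + \<bar>y\<bar>\<^sup>2" by (simp add: power2_diff)
      moreover have "5 * (r/10 + 2/5 * \<bar>y\<bar>)\<^sup>2 = r\<^sup>2 / 20 + 2/5 * (r * \<bar>y\<bar>) + 4/5 * \<bar>y\<bar>\<^sup>2"
        by (simp add: power2_sum power_mult_distrib power_divide)
      moreover have "29/25 * ((9/10 * r)\<^sup>2 + \<bar>y\<bar>\<^sup>2) = 2349/2500 * r\<^sup>2 + 29/25 * \<bar>y\<bar>\<^sup>2"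
        by (simp add: power_mult_distrib power_divide)
      moreover have "0 \<le> r\<^sup>2" "0 \<le> \<bar>y\<bar>\<^sup>2" by simp_all
      ultimately show ?thesis by linarith
    qed
    also have "\<dots> \<le> 29/25 * inner x x" using x2 by simp
    finally have le: "5 * (r/10 + 2/5 * \<bar>y\<bar>)\<^sup>2 \<le> 29/25 * inner x x" .
    have "5 * (r * (r/10 + 2/5 * \<bar>y\<bar>))\<^sup>2 = r\<^sup>2 * (5 * (r/10 + 2/5 * \<bar>y\<bar>)\<^sup>2)"
      unfolding power_mult_distrib[of r] by (simp only: mult.left_commute)
    also have "\<dots> \<le> r\<^sup>2 * (29/25 * inner x x)"
      using le by (intro mult_left_mono) auto
    also have "\<dots> = inner v v * inner x x"
      unfolding vv by simp
    finally have "5 * (r * (r/10 + 2/5 * \<bar>y\<bar>))\<^sup>2 \<le> inner v v * inner x x" .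
    moreover have "inner v x \<le> r * (r/10 + 2/5 * \<bar>y\<bar>)"
      using 1 r by (intro order_trans[OF X] mult_left_mono) auto
    ultimately show ?thesis
      by (intro eel_inequality[of v x "r * (r/10 + 2/5 * \<bar>y\<bar>)"] disjI2)
  next
    case 2
    then have "0 \<le> a - z" using order_trans[OF norm_ge_zero 2] by simp
    then have "a - z \<le> \<bar>y\<bar>" using a by (simp add: y_def)
    \<comment> \<open>Here \<open>12/25 = 2/5 + 2/25\<close>, slope plus cone opening. The opening
      \<open>2/25\<close> is nearly the largest possible:
      \<open>5 * (12/25)^2 = 144/125 = 1.152\<close> against \<open>29/25 = 1.16\<close>.\<close>
    then have "inner v x \<le> r * (12/25 * \<bar>y\<bar>)"
      using 2 r by (intro order_trans[OF X] mult_left_mono) auto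
    moreover have "5 * (r * (12/25 * \<bar>y\<bar>))\<^sup>2 \<le> inner v v * inner x x"
    proof -
      have "5 * (r * (12/25 * \<bar>y\<bar>))\<^sup>2 \<le> 29/25 * r\<^sup>2 * \<bar>y\<bar>\<^sup>2"
      proof -
        have "0 \<le> r\<^sup>2 * \<bar>y\<bar>\<^sup>2" by (intro mult_nonneg_nonneg zero_le_power2)
        moreover have "5 * (r * (12/25 * \<bar>y\<bar>))\<^sup>2 = 144/125 * (r\<^sup>2 * \<bar>y\<bar>\<^sup>2)"
          by (simp add: power_mult_distrib power_divide)
        ultimately show ?thesis by linarith
      qed
      also have "\<dots> \<le> inner v v * inner x x" unfolding vv xx by (intro mult_left_mono) auto
      finally show ?thesis .
    qed
    ultimately show ?thesis by (intro eel_inequality[of v x "r * (12/25 * \<bar>y\<bar>)"] disjI2)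
  qed
qed

section \<open>Passes of growing radius around a vertical axis\<close>

text \<open>One pass consists of a radial move out to the new radius and a helix covering the height
  \<open>H\<close>. The radial move leaves the cylinder of radius \<open>\<rho>\<close>, so it must
  be treated separately from the rest of the past.\<close>

lemma helical_pass:
  assumes g: "partial_eel (1 / sqrt 5) g S l" and gS: "g S = (c + of_real \<rho> * cis \<phi>, \<zeta>)"
    and past: "g ` {0..S} \<subseteq> near_axis c \<rho> a" and r: "0 \<le> \<rho>" "10 * \<rho> \<le> r" "0 < r"
    and \<sigma>: "\<sigma> \<in> {1, -1}" and H: "0 < H" and ab: "\<zeta> \<in> {a..b}" "\<zeta> + \<sigma> * H \<in> {a..b}"
  shows "\<exists>g' S' \<phi>'. partial_eel (1 / sqrt 5) g' S' (l + H) \<and>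
    g' S' = (c + of_real r * cis \<phi>', \<zeta> + \<sigma> * H) \<and> extends g S g' S' (solid_cylinder c r a b)"
proof -
  have S: "0 \<le> S" using g by (simp add: partial_eel_def)
  obtain g1 S1 where g1: "partial_eel (1 / sqrt 5) g1 S1 l" "g1 S1 = (c + of_real r * cis \<phi>, \<zeta>)"
    and e1: "extends g S g1 S1 ((\<lambda>q. (c + of_real q * cis \<phi>, \<zeta>)) ` {\<rho>..r})"
    using radial_segment[OF g gS past, of r] r ab by auto
  \<comment> \<open>This is the angle after which the helix of radius \<open>r\<close> has covered
    the height \<open>H\<close>.\<close>
  define T where "T = 5 * H / (2 * r)"
  have T: "0 < T" "2/5 * r * T = H" using r H by (auto simp: T_def)
  define k where "k = helix c r \<phi> \<zeta> \<sigma>"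
  have height: "a \<le> snd (k s) \<and> snd (k s) \<le> b" if "s \<in> {0..T}" for s
  proof -
    have "2/5 * r * s \<le> H" using that r T(2) mult_left_mono[of s T "2/5 * r"] by auto
    moreover have "0 \<le> 2/5 * r * s" using that r by auto
    ultimately show ?thesis using \<sigma> ab by (auto simp: k_def helix_def)
  qed
  have "\<exists>g' S'. partial_eel (1 / sqrt 5) g' S' (l + H) \<and> S' = S1 + T \<and> g' S' = k T \<and>
      extends g1 S1 g' S' (k ` {0..T})"
  proof (rule partial_eel_extend[where d = "helix_velocity r \<phi> \<sigma>", OF g1(1) T(1)])
    show "k 0 = g1 S1" by (simp add: k_def helix_def g1)
    show "(k has_vector_derivative helix_velocity r \<phi> \<sigma> s) (at s)" for s
      unfolding k_def by (rule helix_has_derivative)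
    show "helix_velocity r \<phi> \<sigma> s \<noteq> 0" for s
      using r \<sigma> by (auto simp: helix_velocity_def zero_prod_def)
    show "inner (helix_velocity r \<phi> \<sigma> s) (p - k s)
        \<le> 1 / sqrt 5 * norm (helix_velocity r \<phi> \<sigma> s) * norm (p - k s)"
      if s: "s \<in> {0..<T}" and p: "p \<in> g1 ` {0..S1}" for s p
    proof -
      consider "p \<in> near_axis c \<rho> a" | q where "q \<in> {\<rho>..r}" "p = (c + of_real q * cis \<phi>, \<zeta>)"
        using extends_image[OF e1 S] past p by blast
      then show ?thesis
      proof cases
        case 1
        then show ?thesis
          using r \<sigma> height[of s] s unfolding k_def
          by (intro helix_inequality_near_axis[of r \<rho> \<sigma> p c a]) auto
      next
        case 2
        then show ?thesis
          using r \<sigma> s unfolding k_def 2(2) by (intro helix_inequality_segment) auto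
      qed
    qed
    show "inner (helix_velocity r \<phi> \<sigma> s) (k s' - k s)
        \<le> 1 / sqrt 5 * norm (helix_velocity r \<phi> \<sigma> s) * norm (k s' - k s)"
      if s': "s' \<in> {0..<s}" for s s'
    proof -
      \<comment> \<open>By screw symmetry the helix may be restarted at \<open>s'\<close>; then
        \<open>k s'\<close> is the end of a radial segment with \<open>q = r\<close>.\<close>
      let ?\<phi> = "\<phi> + s'" and ?\<zeta> = "\<zeta> + 2/5 * \<sigma> * r * s'"
      have "k s' = (c + of_real r * cis ?\<phi>, ?\<zeta>)" by (simp add: k_def helix_def)
      moreover have "k s = helix c r ?\<phi> ?\<zeta> \<sigma> (s - s')"
        by (simp add: k_def helix_def right_diff_distrib diff_divide_distrib)
      moreover have "helix_velocity r \<phi> \<sigma> s = helix_velocity r ?\<phi> \<sigma> (s - s')"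
        by (simp add: helix_velocity_def)
      ultimately show ?thesis
        using helix_inequality_segment[of r r "s - s'" \<sigma> ?\<phi> c ?\<zeta>] r \<sigma> s' by auto
    qed
    \<comment> \<open>Only the vertical extent of the pass is credited as length. This bound does
      not depend on the radius, so arbitrarily thin passes still add up.\<close>
    have "dist (snd (k 0)) (snd (k T)) = \<bar>2/5 * r * T\<bar>"
      using \<sigma> by (auto simp: k_def helix_def dist_real_def)
    then show "l + H \<le> l + dist (k 0) (k T)"
      using dist_snd_le[of "k 0" "k T"] T H by simp
  qed
  then obtain g2 S2 where g2: "partial_eel (1 / sqrt 5) g2 S2 (l + H)" "g2 S2 = k T"
    "extends g1 S1 g2 S2 (k ` {0..T})" by blast
  have "k ` {0..T} \<subseteq> solid_cylinder c r a b"
    using height r by (force simp: solid_cylinder_def k_def helix_def norm_mult)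
  moreover have "(\<lambda>q. (c + of_real q * cis \<phi>, \<zeta>)) ` {\<rho>..r} \<subseteq> solid_cylinder c r a b"
    using r ab by (auto simp: solid_cylinder_def norm_mult)
  ultimately have "extends g S g2 S2 (solid_cylinder c r a b)"
    using extends_trans[OF _ _ S] extends_mono e1 g2(3) by meson
  moreover have "k T = (c + of_real r * cis (\<phi> + T), \<zeta> + \<sigma> * H)"
    unfolding T(2)[symmetric] by (simp add: k_def helix_def)
  ultimately show ?thesis using g2 by metis
qed

text \<open>Each round goes down from height \<open>b\<close> to \<open>a\<close> and up again,
  outside everything wound before. The radius grows outwards by factors of 10, so prescribing the
  outermost radius forces the inner rounds to be tiny; the induction hypothesis is needed for a
  smaller radius, which is why \<open>R\<close> stays general. The curve ends at the top
  \<open>b\<close>, ready to move on upwards.\<close>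

lemma spiral_passes:
  assumes g: "partial_eel (1 / sqrt 5) g S l" and gS: "g S = (c, b)"
    and past: "g ` {0..S} \<subseteq> near_axis c 0 a" and ab: "a < b"
  shows "0 < R \<Longrightarrow> \<exists>g' S' \<rho> \<phi>. 0 \<le> \<rho> \<and> \<rho> \<le> R \<and> partial_eel (1 / sqrt 5) g' S' (l + 2 * real n * (b - a)) \<and>
    g' S' = (c + of_real \<rho> * cis \<phi>, b) \<and> extends g S g' S' (solid_cylinder c \<rho> a b)"
proof (induction n arbitrary: R)
  case 0
  have "extends g S g S (solid_cylinder c 0 a b)"
    using gS ab by (intro extends_refl) (auto simp: solid_cylinder_def)
  then show ?case using 0 g gS by (intro exI[of _ g] exI[of _ S] exI[of _ 0]) auto
next
  case (Suc n)
  have S: "0 \<le> S" using g by (simp add: partial_eel_def)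
  have near: "g' ` {0..S'} \<subseteq> near_axis c r a"
    if "extends g S g' S' (solid_cylinder c r a b)" "0 \<le> r" for g' S' r
    using extends_image[OF that(1) S] past near_axis_mono[OF that(2), of c a] solid_cylinder_near_axis[of c r a b]
    by blast
  have trans: "extends g S g2 S2 (solid_cylinder c r' a b)"
    if "extends g S g1 S1 (solid_cylinder c r a b)" "extends g1 S1 g2 S2 (solid_cylinder c r' a b)" "r \<le> r'"
    for g1 S1 r g2 S2 r'
    using extends_trans[OF extends_mono[OF that(1) solid_cylinder_mono[OF that(3)]] that(2) S] .
  \<comment> \<open>Radius at most \<open>R / 100\<close> for the inner rounds leaves one factor of
    10 for the descent at \<open>R / 10\<close> and one for the ascent at \<open>R\<close>.\<close>
  obtain g1 S1 \<rho> \<phi> where \<rho>: "0 \<le> \<rho>" "\<rho> \<le> R / 100"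
    and g1: "partial_eel (1 / sqrt 5) g1 S1 (l + 2 * real n * (b - a))"
      "g1 S1 = (c + of_real \<rho> * cis \<phi>, b)" "extends g S g1 S1 (solid_cylinder c \<rho> a b)"
    using Suc.IH[of "R / 100"] Suc.prems by auto
  obtain g2 S2 \<phi>2 where
    g2: "partial_eel (1 / sqrt 5) g2 S2 (l + 2 * real n * (b - a) + (b - a))"
      "g2 S2 = (c + of_real (R/10) * cis \<phi>2, a)" "extends g1 S1 g2 S2 (solid_cylinder c (R/10) a b)"
    using helical_pass[OF g1(1,2) near[OF g1(3)], where r = "R/10" and \<sigma> = "-1" and H = "b - a" and b = b]
      \<rho> Suc.prems ab by auto
  have e2: "extends g S g2 S2 (solid_cylinder c (R/10) a b)"
    using trans[OF g1(3) g2(3)] \<rho> Suc.prems by simp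
  obtain g3 S3 \<phi>3 where
    g3: "partial_eel (1 / sqrt 5) g3 S3 (l + 2 * real n * (b - a) + (b - a) + (b - a))"
      "g3 S3 = (c + of_real R * cis \<phi>3, b)" "extends g2 S2 g3 S3 (solid_cylinder c R a b)"
    using helical_pass[OF g2(1,2) near[OF e2], where r = R and \<sigma> = 1 and H = "b - a" and b = b]
      Suc.prems ab by auto
  have "extends g S g3 S3 (solid_cylinder c R a b)"
    using trans[OF e2 g3(3)] Suc.prems by simp
  then show ?case
    using g3 Suc.prems by (intro exI[of _ g3] exI[of _ S3] exI[of _ R] exI[of _ \<phi>3]) (auto simp: algebra_simps)
qed

section \<open>Batches of passes with summable heights\<close>

lemma partial_eel_mono: "partial_eel lam g S l \<Longrightarrow> l' \<le> l \<Longrightarrow> partial_eel lam g S l'"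
  unfolding partial_eel_def length_ge_def by (blast intro: order_trans)

text \<open>
After moving up by \<open>G\<close>, the whole past lies in the narrow cone below the current point.
\<close>

definition above_past :: "(real \<Rightarrow> complex \<times> real) \<Rightarrow> real \<Rightarrow> real \<Rightarrow> bool" where
  "above_past g S G \<longleftrightarrow> (\<forall>(w, z)\<in>g ` {0..S}. z \<le> snd (g S) \<and>
     cmod (w - fst (g S)) \<le> 2/25 * (snd (g S) + G - z))"

text \<open>The curve first rises vertically by \<open>2 * G\<close>. The lower half of this rise
  puts the older past into the cone with apex \<open>(c, h + G)\<close>; the upper half is the axis
  around which the passes between \<open>h + G\<close> and \<open>h + 2 * G\<close> are wound. The
  number of passes is chosen after \<open>G\<close>, so the length gained is at least 1 however
  small \<open>G\<close> is. The rise takes parameter time 1, so the domains exhaust the half-line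
  when batches are iterated.\<close>

lemma spiral_batch:
  assumes g: "partial_eel (1 / sqrt 5) g S l" and ab: "above_past g S G" and G: "0 < G"
  shows "\<exists>g' S'. partial_eel (1 / sqrt 5) g' S' (l + 1) \<and> above_past g' S' (G / 2) \<and> S + 1 \<le> S' \<and>
    extends g S g' S' (cball (g S) (3 * G))"
proof -
  have S: "0 \<le> S" using g by (simp add: partial_eel_def)
  obtain c h where gS: "g S = (c, h)" by (cases "g S")
  have old: "z \<le> h" "cmod (w - c) \<le> 2/25 * (h + G - z)" if "(w, z) \<in> g ` {0..S}" for w z
    using ab that gS by (auto simp: above_past_def)
  define k where "k = (\<lambda>s::real. (c, h + 2 * G * s))"
  have "\<exists>g' S'. partial_eel (1 / sqrt 5) g' S' l \<and> S' = S + 1 \<and> g' S' = k 1 \<and>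
      extends g S g' S' (k ` {0..1})"
  proof (rule partial_eel_extend[where d = "\<lambda>_. (0, 2 * G)", OF g])
    show "(k has_vector_derivative (0, 2 * G)) (at s)" for s
      unfolding k_def by (auto intro!: derivative_eq_intros has_vector_derivative_Pair)
    show "inner (0, 2 * G) (p - k s) \<le> 1 / sqrt 5 * norm (0::complex, 2 * G) * norm (p - k s)"
      if s: "s \<in> {0..<1}" and p: "p \<in> g ` {0..S}" for s p
    proof (rule eel_inequality[of _ _ 0])
      obtain w z where wz: "p = (w, z)" by (cases p)
      have "z \<le> h + 2 * G * s" using old(1)[of w z] p wz s G by (auto intro: order_trans[of z h])
      then show "inner (0, 2 * G) (p - k s) \<le> 0"
        using G by (simp add: wz k_def mult_nonneg_nonpos)
    qed simp
    show "inner (0, 2 * G) (k s' - k s) \<le> 1 / sqrt 5 * norm (0::complex, 2 * G) * norm (k s' - k s)"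
      if s: "s' \<in> {0..<s}" for s s'
    proof (rule eel_inequality[of _ _ 0])
      have "G * s' \<le> G * s" using s G by (intro mult_left_mono) auto
      then show "inner (0, 2 * G) (k s' - k s) \<le> 0"
        using G by (simp add: k_def mult_nonneg_nonpos)
    qed simp
  qed (use G gS in \<open>auto simp: k_def zero_prod_def\<close>)
  then obtain g1 S1 where g1: "partial_eel (1 / sqrt 5) g1 S1 l" "S1 = S + 1" "g1 S1 = (c, h + 2 * G)"
    "extends g S g1 S1 (k ` {0..1})" by (auto simp: k_def)
  have past: "g1 ` {0..S1} \<subseteq> g ` {0..S} \<union> k ` {0..1}"
    by (rule extends_image[OF g1(4) S])
  have near: "g1 ` {0..S1} \<subseteq> near_axis c 0 (h + G)"
  proof
    fix p assume "p \<in> g1 ` {0..S1}"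
    then consider "p \<in> g ` {0..S}" | "p \<in> k ` {0..1}" using past by blast
    then show "p \<in> near_axis c 0 (h + G)"
      using old(2) by cases (auto simp: near_axis_def k_def)
  qed
  obtain n where n: "1 / G \<le> real n" using real_arch_simple by blast
  have nG: "1 \<le> real n * G" using n G by (simp add: field_simps)
  \<comment> \<open>The radius \<open>G / 50\<close> is what the next batch tolerates: a point of
    the new cylinder is within \<open>G/50 + G/50 = 2/25 * (G/2)\<close> horizontally of the new
    endpoint, as \<open>above_past\<close> with \<open>G / 2\<close> demands at the top
    height.\<close>
  obtain g2 S2 \<rho> \<phi> where \<rho>: "0 \<le> \<rho>" "\<rho> \<le> G / 50"
    and g2: "partial_eel (1 / sqrt 5) g2 S2 (l + 2 * real n * (h + 2 * G - (h + G)))"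
      "g2 S2 = (c + of_real \<rho> * cis \<phi>, h + 2 * G)"
      "extends g1 S1 g2 S2 (solid_cylinder c \<rho> (h + G) (h + 2 * G))"
    using spiral_passes[OF g1(1,3) near, of "G / 50" n] G by auto
  have p2: "partial_eel (1 / sqrt 5) g2 S2 (l + 1)"
    using nG by (intro partial_eel_mono[OF g2(1)]) simp
  define Q where "Q = solid_cylinder c (G / 50) h (h + 2 * G)"
  have kQ: "k ` {0..1} \<subseteq> Q"
    using G by (auto simp: Q_def solid_cylinder_def k_def)
  have cQ: "solid_cylinder c \<rho> (h + G) (h + 2 * G) \<subseteq> Q"
    using G \<rho> by (auto simp: Q_def solid_cylinder_def)
  have eQ: "extends g S g2 S2 Q"
    by (rule extends_trans[OF extends_mono[OF g1(4) kQ] extends_mono[OF g2(3) cQ] S])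
  have "Q \<subseteq> cball (g S) (3 * G)"
  proof
    fix p assume "p \<in> Q"
    then obtain w z where wz: "p = (w, z)" "cmod (w - c) \<le> G / 50" "h \<le> z" "z \<le> h + 2 * G"
      by (auto simp: Q_def solid_cylinder_def)
    have "dist (g S) p \<le> dist c w + dist h z"
      unfolding gS wz(1) dist_Pair_Pair by (rule sqrt_sum_squares_le_sum) auto
    also have "\<dots> \<le> 3 * G" using wz G by (simp add: dist_norm norm_minus_commute)
    finally show "p \<in> cball (g S) (3 * G)" by simp
  qed
  with eQ have e: "extends g S g2 S2 (cball (g S) (3 * G))" by (rule extends_mono)
  have "above_past g2 S2 (G / 2)"
    unfolding above_past_def g2(2) fst_conv snd_conv
  proof (safe)
    fix t assume t: "t \<in> {0..S2}"
    fix w z assume wz: "(w, z) = g2 t"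
    have in_g2: "(w, z) \<in> g2 ` {0..S2}" using wz t by (metis imageI)
    have shift: "cmod (w - (c + of_real \<rho> * cis \<phi>)) \<le> cmod (w - c) + \<rho>"
      using norm_triangle_ineq4[of "w - c" "of_real \<rho> * cis \<phi>"] \<rho> by (simp add: norm_mult algebra_simps)
    consider "(w, z) \<in> g ` {0..S}" | "(w, z) \<in> Q"
      using extends_image[OF eQ S] in_g2 by blast
    then have "z \<le> h + 2 * G \<and> cmod (w - (c + of_real \<rho> * cis \<phi>)) \<le> 2/25 * (h + 2 * G + G / 2 - z)"
    proof cases
      case 1
      then show ?thesis using old[OF 1] shift \<rho> G by (simp add: algebra_simps)
    next
      case 2
      then have "z \<le> h + 2 * G" "cmod (w - c) \<le> G / 50" by (auto simp: Q_def solid_cylinder_def)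
      then show ?thesis using shift \<rho> G by (simp add: algebra_simps)
    qed
    then show "z \<le> h + 2 * G" "cmod (w - (c + of_real \<rho> * cis \<phi>)) \<le> 2/25 * (h + 2 * G + G / 2 - z)"
      by auto
  qed
  moreover have "S + 1 \<le> S2" using g1(2) g2(3) by (simp add: extends_def)
  ultimately show ?thesis using p2 e by blast
qed

text \<open>Batches are iterated with \<open>G = (1/2)^n / 6\<close>, which halves each time as
  \<open>spiral_batch\<close> requires. The displacement bound \<open>3 * G\<close> equals
  \<open>(1/2)^n / 2\<close>, exactly the growth of the enclosing radius from
  \<open>1 - (1/2)^n\<close> to \<open>1 - (1/2)^Suc n\<close>.\<close>

lemma bounded_spirals:
  "\<exists>f :: nat \<Rightarrow> (real \<Rightarrow> complex \<times> real) \<times> real. \<forall>n.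
     partial_eel (1 / sqrt 5) (fst (f n)) (snd (f n)) (real n) \<and> real n \<le> snd (f n) \<and>
     fst (f n) ` {0..snd (f n)} \<subseteq> cball 0 (1 - (1/2)^n) \<and>
     extends (fst (f n)) (snd (f n)) (fst (f (Suc n))) (snd (f (Suc n)))
       (cball (fst (f n) (snd (f n))) ((1/2)^n / 2))"
proof -
  define P where "P = (\<lambda>n (g :: real \<Rightarrow> complex \<times> real, S).
     partial_eel (1 / sqrt 5) g S (real n) \<and> real n \<le> S \<and>
     g ` {0..S} \<subseteq> cball 0 (1 - (1/2)^n) \<and> above_past g S ((1/2)^n / 6))"
  define Q where "Q = (\<lambda>(n::nat) (g :: real \<Rightarrow> complex \<times> real, S) (g', S').
     extends g S g' S' (cball (g S) ((1/2)^n / 2)))"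
  have "\<exists>f. \<forall>n. P n (f n) \<and> Q n (f n) (f (Suc n))"
  proof (rule dependent_nat_choice)
    \<comment> \<open>The start is the single point 0 with \<open>S = 0\<close>: the eel condition
      on \<open>{0..<0}\<close> is vacuous, and the polygon \<open>[0]\<close> has length 0.\<close>
    have "partial_eel (1 / sqrt 5) (\<lambda>_. 0 :: complex \<times> real) 0 0"
      unfolding partial_eel_def length_ge_def
      by (auto intro!: exI[of _ "[0]"] simp: polygon_length_def)
    then show "\<exists>x. P 0 x"
      by (intro exI[of _ "(\<lambda>_. 0, 0)"]) (auto simp: P_def above_past_def zero_prod_def)
  next
    fix x n assume "P n x"
    obtain g S where x: "x = (g, S)" by (cases x)
    have g: "partial_eel (1 / sqrt 5) g S (real n)" "real n \<le> S"
      "g ` {0..S} \<subseteq> cball 0 (1 - (1/2)^n)" "above_past g S ((1/2)^n / 6)"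
      using \<open>P n x\<close> by (auto simp: P_def x)
    obtain g' S' where g': "partial_eel (1 / sqrt 5) g' S' (real n + 1)" "above_past g' S' ((1/2)^n / 6 / 2)"
        "S + 1 \<le> S'" "extends g S g' S' (cball (g S) (3 * ((1/2)^n / 6)))"
      using spiral_batch[OF g(1,4)] by auto
    have S: "0 \<le> S" using g(1) by (simp add: partial_eel_def)
    have gS: "dist 0 (g S) \<le> 1 - (1/2)^n" using g(3) S by (auto simp: image_subset_iff)
    have "cball (g S) (3 * ((1/2)^n / 6)) \<subseteq> cball 0 (1 - (1/2)^Suc n)"
    proof
      fix p assume "p \<in> cball (g S) (3 * ((1/2)^n / 6))"
      then show "p \<in> cball 0 (1 - (1/2)^Suc n)"
        using gS dist_triangle[of 0 p "g S"] by (simp del: dist_0_norm)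
    qed
    moreover have "cball 0 (1 - (1/2)^n) \<subseteq> cball (0 :: complex \<times> real) (1 - (1/2)^Suc n)"
      by (rule subset_cball) simp
    ultimately have "g' ` {0..S'} \<subseteq> cball 0 (1 - (1/2)^Suc n)"
      using extends_image[OF g'(4) S] g(3) by blast
    then have "P (Suc n) (g', S')" using g' g(2) by (simp add: P_def add.commute)
    moreover have "Q n x (g', S')" using g'(4) by (simp add: Q_def x)
    ultimately show "\<exists>y. P (Suc n) y \<and> Q n x y" by blast
  qed
  then show ?thesis by (fastforce simp: P_def Q_def split_beta)
qed

section \<open>Transfer to three-dimensional space\<close>

text \<open>The construction lives in \<open>complex \<times> real\<close> so that horizontal
  rotations are multiplications by \<open>cis\<close>; this linear isometry carries the result
  over.\<close>

definition to_vec3 :: "complex \<times> real \<Rightarrow> real^3" where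
  "to_vec3 p = vector [Re (fst p), Im (fst p), snd p]"

lemma inner_to_vec3 [simp]: "inner (to_vec3 p) (to_vec3 q) = inner p q"
  by (simp add: to_vec3_def inner_vec_def sum_3 inner_prod_def inner_complex_def)

lemma norm_to_vec3 [simp]: "norm (to_vec3 p) = norm p"
  by (simp add: norm_eq_sqrt_inner)

lemma linear_to_vec3: "linear to_vec3"
  by (rule linearI) (auto simp: to_vec3_def vec_eq_iff forall_3)

lemma bounded_linear_to_vec3: "bounded_linear to_vec3"
  using linear_to_vec3 by (simp add: linear_conv_bounded_linear)

lemma to_vec3_diff: "to_vec3 p - to_vec3 q = to_vec3 (p - q)"
  using linear_to_vec3 by (simp add: linear_diff)

lemma dist_to_vec3 [simp]: "dist (to_vec3 p) (to_vec3 q) = dist p q"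
  by (simp add: dist_norm to_vec3_diff)

lemma eel_at_to_vec3:
  assumes "eel_at lam g tau"
  shows "eel_at lam (\<lambda>t. to_vec3 (g t)) tau"
proof -
  obtain v where v: "v \<noteq> 0" "(g has_vector_derivative v) (at tau within {tau..})"
    "\<forall>t\<in>{0..<tau}. inner v (g t - g tau) \<le> lam * norm v * norm (g t - g tau)"
    using assms by (auto simp: eel_at_def)
  have "to_vec3 v \<noteq> 0" using v(1) norm_to_vec3[of v] by (metis norm_eq_zero)
  moreover have "((\<lambda>t. to_vec3 (g t)) has_vector_derivative to_vec3 v) (at tau within {tau..})"
    by (rule bounded_linear.has_vector_derivative[OF bounded_linear_to_vec3 v(2)])
  ultimately show ?thesis
    unfolding eel_at_def using v(3) by (intro exI[of _ "to_vec3 v"]) (simp add: to_vec3_diff)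
qed

section \<open>The limit curve and the theorem\<close>

text \<open>Successive partial eels agree on their common domains, so they glue to one curve.
  Continuity, the eel condition and the length bounds are inherited from a single stage, while the
  summable displacements give the limit.\<close>

lemma infinite_eel:
  "\<exists>g :: real \<Rightarrow> complex \<times> real. continuous_on {0..} g \<and> (\<forall>tau\<ge>0. eel_at (1 / sqrt 5) g tau) \<and>
     g ` {0..} \<subseteq> cball 0 1 \<and> (\<forall>n::nat. \<exists>S. length_ge g S (real n)) \<and> (\<exists>L. (g \<longlongrightarrow> L) at_top)"
proof -
  obtain f :: "nat \<Rightarrow> (real \<Rightarrow> complex \<times> real) \<times> real" where f: "\<forall>n.
     partial_eel (1 / sqrt 5) (fst (f n)) (snd (f n)) (real n) \<and> real n \<le> snd (f n) \<and>
     fst (f n) ` {0..snd (f n)} \<subseteq> cball 0 (1 - (1/2)^n) \<and>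
     extends (fst (f n)) (snd (f n)) (fst (f (Suc n))) (snd (f (Suc n)))
       (cball (fst (f n) (snd (f n))) ((1/2)^n / 2))"
    using bounded_spirals by blast
  define \<gamma> where "\<gamma> n = fst (f n)" for n
  define S where "S n = snd (f n)" for n
  have eel: "partial_eel (1 / sqrt 5) (\<gamma> n) (S n) (real n)" and S_ge: "real n \<le> S n"
    and im: "\<gamma> n ` {0..S n} \<subseteq> cball 0 (1 - (1/2)^n)"
    and ext: "extends (\<gamma> n) (S n) (\<gamma> (Suc n)) (S (Suc n)) (cball (\<gamma> n (S n)) ((1/2)^n / 2))" for n
    using f by (auto simp: \<gamma>_def S_def)
  have S0: "0 \<le> S n" for n using S_ge[of n] by (meson of_nat_0_le_iff order_trans)
  have mono: "mono S"
    using ext by (intro incseq_SucI) (auto simp: extends_def)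
  have agree: "\<gamma> m t = \<gamma> n t" if "n \<le> m" "t \<in> {0..S n}" for n m t
    using that(1)
  proof (induction m rule: dec_induct)
    case (step m)
    then have "t \<in> {0..S m}" using that(2) monoD[OF mono, of n m] by auto
    then show ?case using ext[of m] step by (auto simp: extends_def)
  qed simp
  \<comment> \<open>The stage \<open>nat \<lceil>t\<rceil>\<close> is late enough because
    \<open>real n \<le> S n\<close>; every other stage with \<open>t \<le> S n\<close> gives the
    same value.\<close>
  define g where "g t = \<gamma> (nat \<lceil>t\<rceil>) t" for t
  have g: "g t = \<gamma> n t" if "0 \<le> t" "t \<le> S n" for n t
  proof -
    define N where "N = nat \<lceil>t\<rceil>"
    have "t \<le> S N" using S_ge[of N] unfolding N_def by linarith
    then have "\<gamma> N t = \<gamma> n t"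
      using agree[of n N t] agree[of N n t] that by (cases "n \<le> N") auto
    then show ?thesis by (simp add: g_def N_def)
  qed
  have beyond: "\<exists>n. t < S n" for t
    using reals_Archimedean2[of t] S_ge by (meson less_le_trans)
  have "continuous_on {0..} g"
    unfolding continuous_on_eq_continuous_within
  proof
    fix t :: real assume t: "t \<in> {0..}"
    obtain n where n: "t < S n" using beyond by blast
    have "continuous_on {0..S n} g"
      using eel[of n] g[of _ n] by (subst continuous_on_cong[OF refl, of _ _ "\<gamma> n"]) (auto simp: partial_eel_def)
    then have "continuous (at t within {0..S n}) g"
      using t n by (auto simp: continuous_on_eq_continuous_within)
    moreover have "at t within {0..} = at t within {0..S n}"
      by (rule at_within_nhd[of t "{..<S n}"]) (use n in auto)
    ultimately show "continuous (at t within {0..}) g" by simp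
  qed
  moreover have "eel_at (1 / sqrt 5) g t" if "0 \<le> t" for t
  proof -
    obtain n where n: "t < S n" using beyond by blast
    show ?thesis
      by (rule eel_at_cong[of _ "\<gamma> n" t "S n - t"]) (use that n eel[of n] g[of _ n] in \<open>auto simp: partial_eel_def\<close>)
  qed
  moreover have "g ` {0..} \<subseteq> cball 0 1"
  proof
    fix p assume "p \<in> g ` {0..}"
    then obtain t where t: "0 \<le> t" "p = g t" by auto
    obtain n where "t < S n" using beyond by blast
    then have "p \<in> cball 0 (1 - (1/2)^n)" using im[of n] t g[of t n] by (auto simp: image_subset_iff)
    moreover have "0 \<le> (1/2::real)^n" by simp
    ultimately show "p \<in> cball 0 1" by (simp del: zero_le_power)
  qed
  moreover have "length_ge g (S n) (real n)" for n
  proof -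
    obtain ts where ts: "sorted_wrt (<) ts" "set ts \<subseteq> {0..S n}" "ts \<noteq> []" "last ts = S n"
      "real n \<le> polygon_length (\<gamma> n) ts" using eel[of n] by (auto simp: partial_eel_def length_ge_def)
    have "polygon_length (\<gamma> n) ts = polygon_length g ts"
      using ts(2) g[of _ n] by (intro polygon_length_cong) (auto simp: subset_iff)
    then show ?thesis using ts by (auto simp: length_ge_def)
  qed
  moreover have "\<exists>L. (g \<longlongrightarrow> L) at_top"
  proof -
    \<comment> \<open>Subtracting \<open>(1/2)^(n + k)\<close> makes the induction close:
      \<open>(1/2)^n / 2\<close> for the first batch plus the bound from \<open>Suc n\<close> on is
      again of this form.\<close>
    have tail_bound: "dist (g (S n)) (g t) \<le> (1/2)^n - (1/2)^(n + k)" if "t \<in> {S n..S (n + k)}" for n k t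
      using that
    proof (induction k arbitrary: n)
      case (Suc k)
      have near: "dist (g (S n)) (g t) \<le> (1/2)^n / 2" if "t \<in> {S n..S (Suc n)}" for t
        using that ext[of n] g[of t "Suc n"] g[of "S n" n] S0[of n] by (auto simp: extends_def image_subset_iff)
      show ?case
      proof (cases "t \<le> S (Suc n)")
        case True
        have "(1/2::real)^(n + Suc k) \<le> (1/2)^n / 2"
          using power_decreasing[of "Suc n" "n + Suc k" "1/2::real"] by simp
        moreover have "dist (g (S n)) (g t) \<le> (1/2)^n / 2" using True Suc.prems by (intro near) auto
        ultimately show ?thesis by linarith
      next
        case False
        then have "dist (g (S (Suc n))) (g t) \<le> (1/2)^Suc n - (1/2)^(Suc n + k)"
          using Suc.prems by (intro Suc.IH) auto
        moreover have "dist (g (S n)) (g (S (Suc n))) \<le> (1/2)^n / 2"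
          using near[of "S (Suc n)"] monoD[OF mono, of n "Suc n"] by auto
        ultimately show ?thesis
          using dist_triangle[of "g (S n)" "g t" "g (S (Suc n))"] by simp
      qed
    qed simp
    have tail: "dist (g (S n)) (g t) \<le> (1/2)^n" if "S n \<le> t" for n t
    proof -
      obtain m where m: "t < S m" using beyond by blast
      have "S m \<le> S (n + m)" by (rule monoD[OF mono]) simp
      then have "dist (g (S n)) (g t) \<le> (1/2)^n - (1/2)^(n + m)"
        using m that by (intro tail_bound) auto
      moreover have "0 \<le> (1/2::real)^(n + m)" by simp
      ultimately show ?thesis by linarith
    qed
    have small: "\<exists>N. \<forall>n\<ge>N. (1/2::real)^n < e" if "0 < e" for e
    proof -
      have "(\<lambda>n. (1/2::real)^n) \<longlonglongrightarrow> 0" by (rule LIMSEQ_power_zero) simp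
      from LIMSEQ_D[OF this that] show ?thesis by simp
    qed
    have "Cauchy (\<lambda>n. g (S n))"
    proof (rule metric_CauchyI)
      fix e :: real assume "0 < e"
      then obtain N where N: "(1/2::real)^N < e / 2" using small[of "e / 2"] by auto
      have "dist (g (S m)) (g (S n)) < e" if "N \<le> m" "N \<le> n" for m n
        using tail[of N "S m"] tail[of N "S n"] monoD[OF mono that(1)] monoD[OF mono that(2)] N
          dist_triangle3[of "g (S m)" "g (S n)" "g (S N)"] by linarith
      then show "\<exists>M. \<forall>m\<ge>M. \<forall>n\<ge>M. dist (g (S m)) (g (S n)) < e" by blast
    qed
    then obtain L where L: "(\<lambda>n. g (S n)) \<longlonglongrightarrow> L" using Cauchy_convergent convergent_def by blast
    have "(g \<longlongrightarrow> L) at_top"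
    proof (rule tendstoI)
      fix e :: real assume e: "0 < e"
      then obtain N where N: "\<forall>n\<ge>N. (1/2::real)^n < e / 2" using small[of "e / 2"] by auto
      obtain M where M: "\<forall>n\<ge>M. dist (g (S n)) L < e / 2"
        using metric_LIMSEQ_D[OF L, of "e / 2"] e by auto
      define n where "n = max M N"
      have n: "(1/2::real)^n < e / 2" "dist (g (S n)) L < e / 2" using M N by (auto simp: n_def)
      have "dist (g t) L < e" if "S n \<le> t" for t
        using tail[OF that] n dist_triangle3[of "g t" L "g (S n)"] by linarith
      then show "eventually (\<lambda>t. dist (g t) L < e) at_top"
        using eventually_at_top_linorder by blast
    qed
    then show ?thesis by blast
  qed
  ultimately show ?thesis by blast
qed

theorem theorem4p2:
  shows "\<exists>g :: real \<Rightarrow> real^3.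
           is_eel (1 / sqrt 5) {0..} g \<and>
           g ` {0..} \<subseteq> cball 0 1 \<and>
           curve_length {0..} g = \<infinity> \<and>
           (\<exists>L. (g \<longlongrightarrow> L) at_top)"
proof -
  obtain g :: "real \<Rightarrow> complex \<times> real" and L where g: "continuous_on {0..} g"
    "\<And>tau. 0 \<le> tau \<Longrightarrow> eel_at (1 / sqrt 5) g tau" "g ` {0..} \<subseteq> cball 0 1"
    "\<And>n::nat. \<exists>S. length_ge g S (real n)" "(g \<longlongrightarrow> L) at_top"
    using infinite_eel by blast
  define h where "h t = to_vec3 (g t)" for t
  have "is_eel (1 / sqrt 5) {0..} h"
    unfolding is_eel_def
  proof (intro conjI ballI)
    show "continuous_on {0..} h"
      unfolding h_def by (rule bounded_linear.continuous_on[OF bounded_linear_to_vec3 g(1)])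
    fix tau :: real assume tau: "tau \<in> {0..}"
    have "{0..} \<inter> {tau..} = {tau..}" using tau by auto
    then show "\<exists>v. v \<noteq> 0 \<and> right_deriv_at h {0..} tau v \<and>
        (\<forall>t\<in>{0..}. t < tau \<longrightarrow> inner v (h t - h tau) \<le> 1 / sqrt 5 * norm v * norm (h t - h tau))"
      using eel_at_to_vec3[OF g(2), of tau] tau unfolding right_deriv_at_def eel_at_def h_def by auto
  qed (rule is_interval_ci)
  moreover have "h ` {0..} \<subseteq> cball 0 1" using g(3) by (auto simp: h_def image_subset_iff)
  moreover have "curve_length {0..} h = \<infinity>"
    unfolding curve_length_def
  proof (rule SUP_PInfty)
    fix n :: nat
    obtain S ts where ts: "sorted_wrt (<) ts" "set ts \<subseteq> {0..S}" "real n \<le> polygon_length g ts"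
      using g(4)[of n] by (auto simp: length_ge_def)
    then have "ereal (real n) \<le> ereal (\<Sum>i<length ts - 1. dist (h (ts ! i)) (h (ts ! Suc i)))"
      by (simp add: polygon_length_def h_def)
    moreover have "set ts \<subseteq> {0..}" using ts(2) by auto
    ultimately show "\<exists>ts\<in>{ts. sorted_wrt (<) ts \<and> set ts \<subseteq> {0..}}.
        ereal (real n) \<le> ereal (\<Sum>i<length ts - 1. dist (h (ts ! i)) (h (ts ! Suc i)))"
      using ts(1) by blast
  qed
  moreover have "(h \<longlongrightarrow> to_vec3 L) at_top"
    unfolding h_def by (rule bounded_linear.tendsto[OF bounded_linear_to_vec3 g(5)])
  ultimately show ?thesis by blast
qed

end
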